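(* For any positive integer $n$, the semigroup (under composition) of all injective endomorphisms of the semigroup $\boldsymbol{B}_{\omega}^{\mathscr{F}_n}$ is isomorphic to the semigroup $(\omega,+)$. In particular, the group of automorphisms of $\boldsymbol{B}_{\omega}^{\mathscr{F}_n}$ is trivial.
   Context: $\omega$ is the set of all non-negative integers, and $(\omega,+)$ is $\omega$ with usual addition. For $k\in\omega$ put $[0;k]=\{0,1,\ldots,k\}$. For an integer $m$ and $F\subseteq\omega$ put $m+F=\{m+x\colon x\in F\}$ (a set of integers), with $m+\varnothing=\varnothing$. For $n\in\omega$ let $\mathscr{F}_n=\{\varnothing\}\cup\{[0;k]\colon k=0,\ldots,n\}$. On $\omega\times\omega\times\mathscr{F}_n$ define the associative operation $$(i_1,j_1,F_1)\cdot(i_2,j_2,F_2)=\begin{cases}(i_1-j_1+i_2,\,j_2,\,(j_1-i_2+F_1)\cap F_2), & \text{if } j_1\leqslant i_2;\\ (i_1,\,j_1-i_2+j_2,\,F_1\cap(i_2-j_1+F_2)), & \text{if } j_1\geqslant i_2.\end{cases}$$ The set $\boldsymbol{I}=\{(i,j,\varnothing)\colon i,j\in\omega\}$ is an ideal, and $\boldsymbol{B}_{\omega}^{\mathscr{F}_n}$ is the Rees quotient semigroup $(\omega\times\omega\times\mathscr{F}_n,\cdot)/\boldsymbol{I}$, i.e. $\boldsymbol{I}$ is collapsed to a single zero element $\boldsymbol{0}$; its non-zero elements are the triples $(i,j,[0;k])$ with $i,j\in\omega$, $0\leqslant k\leqslant n$. An endomorphism of a semigroup is a homomorphism to itself; an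 automorphism is a bijective endomorphism. *)

theory Defs
  imports "HOL-Algebra.Elementary_Groups" "HOL-Algebra.Bij"
begin

(* HOL-Algebra has no record type for semigroups. The semigroups below that need not have
   an identity are monoid records whose field one is left undefined; hom, mon, iso and
   AutoGroup do not refer to that field. *)

definition translate :: "int \<Rightarrow> nat set \<Rightarrow> int set" where
  "translate m F = (\<lambda>x. m + int x) ` F"

definition initial_intervals :: "nat \<Rightarrow> nat set set" where
  "initial_intervals n = insert {} ((\<lambda>k. {0..k}) ` {0..n})"

(* The translated set may contain negative integers; they are discarded by the
   intersection with a set of natural numbers. *)
definition triple_mult ::
    "nat \<times> nat \<times> nat set \<Rightarrow> nat \<times> nat \<times> nat set \<Rightarrow> nat \<times> nat \<times> nat set" where
  "triple_mult = (\<lambda>(i1, j1, F1) (i2, j2, F2).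
     if j1 \<le> i2
     then (i1 + (i2 - j1), j2, {x \<in> F2. int x \<in> translate (int j1 - int i2) F1})
     else (i1, (j1 - i2) + j2, {x \<in> F1. int x \<in> translate (int i2 - int j1) F2}))"

definition triple_semigroup :: "nat \<Rightarrow> (nat \<times> nat \<times> nat set) monoid" where
  "triple_semigroup n =
     \<lparr>carrier = UNIV \<times> UNIV \<times> initial_intervals n, mult = triple_mult, one = undefined\<rparr>"

definition empty_ideal :: "(nat \<times> nat \<times> nat set) set" where
  "empty_ideal = {(i, j, {}) |i j. True}"

definition rees_cong :: "('a, 'c) monoid_scheme \<Rightarrow> 'a set \<Rightarrow> 'a rel" where
  "rees_cong S I = Id_on (carrier S) \<union> I \<times> I"

(* For an ideal I the classes united in the product all coincide. *)
definition rees_quotient :: "('a, 'c) monoid_scheme \<Rightarrow> 'a set \<Rightarrow> 'a set monoid" where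
  "rees_quotient S I =
     \<lparr>carrier = carrier S // rees_cong S I,
      mult = (\<lambda>X Y. \<Union>x\<in>X. \<Union>y\<in>Y. rees_cong S I `` {x \<otimes>\<^bsub>S\<^esub> y}),
      one = undefined\<rparr>"

definition B_omega :: "nat \<Rightarrow> (nat \<times> nat \<times> nat set) set monoid" where
  "B_omega n = rees_quotient (triple_semigroup n) empty_ideal"

(* Extensional functions, as in Bij, so that equality of endomorphisms is equality on
   the carrier. *)
definition inj_endo_monoid :: "('a, 'c) monoid_scheme \<Rightarrow> ('a \<Rightarrow> 'a) monoid" where
  "inj_endo_monoid S =
     \<lparr>carrier = mon S S \<inter> extensional (carrier S),
      mult = (\<lambda>g f. compose (carrier S) g f),
      one = (\<lambda>x\<in>carrier S. x)\<rparr>"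

definition nat_add_monoid :: "nat monoid" where
  "nat_add_monoid = \<lparr>carrier = UNIV, mult = (+), one = 0\<rparr>"

end

theory Submission
  imports Defs
begin

text \<open>
  The triple (i, j, [0;k]) behaves as the translation of the interval [i, i+k] onto [j, j+k], multiplied
  as partial maps, so the non-zero idempotents are the intervals with at most n+1 points and
  the order of idempotents is inclusion. An injective endomorphism fixes zero, since only
  finitely many idempotents lie above a given interval, and it preserves the number of points
  of an interval, since the chain [i, i], ..., [i, i+n] has the maximal length. On one-point
  intervals it is thus an injection f of the natural numbers, and because two-point intervals are
  preserved (this needs n \<ge> 1) consecutive values of f differ by one. Hence f is
  translation by some a, and the endomorphism sends (i, j, [0;k]) to (a+i, a+j, [0;k]), as an element
  is determined by its domain and range.
\<close>

section \<open>Coordinates and multiplication in the quotient\<close>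

text \<open>Non-zero elements of the Rees quotient are singleton classes; the zero is the whole
  class \<open>empty_ideal\<close>.\<close>

definition el :: "nat \<Rightarrow> nat \<Rightarrow> nat \<Rightarrow> (nat \<times> nat \<times> nat set) set" where
  "el i j k = {(i, j, {0..k})}"

lemma el_inject [simp]: "el i j k = el i' j' k' \<longleftrightarrow> i = i' \<and> j = j' \<and> k = k'"
  by (auto simp: el_def)

lemma el_neq_empty_ideal [simp]: "el i j k \<noteq> empty_ideal" "empty_ideal \<noteq> el i j k"
proof -
  have "(i, j, {0..k}) \<notin> empty_ideal"
    by (simp add: empty_ideal_def)
  then show "el i j k \<noteq> empty_ideal" "empty_ideal \<noteq> el i j k"
    by (auto simp: el_def)
qed

lemma rees_cong_Image:
  assumes "I \<subseteq> carrier S" "x \<in> carrier S"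
  shows "rees_cong S I `` {x} = (if x \<in> I then I else {x})"
  using assms by (auto simp: rees_cong_def)

lemma empty_ideal_subset: "empty_ideal \<subseteq> carrier (triple_semigroup n)"
  by (auto simp: empty_ideal_def triple_semigroup_def initial_intervals_def)

lemma carrier_triple_semigroup:
  "carrier (triple_semigroup n) = empty_ideal \<union> {(i, j, {0..k}) |i j k. k \<le> n}"
  by (auto simp: empty_ideal_def triple_semigroup_def initial_intervals_def)

lemma carrier_B_omega: "carrier (B_omega n) = insert empty_ideal {el i j k |i j k. k \<le> n}"
proof -
  have cl: "rees_cong (triple_semigroup n) empty_ideal `` {x} =
      (if x \<in> empty_ideal then empty_ideal else {x})" if "x \<in> carrier (triple_semigroup n)" for x
    using rees_cong_Image[OF empty_ideal_subset that] .
  have "carrier (B_omega n) =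
      (\<lambda>x. if x \<in> empty_ideal then empty_ideal else {x}) ` carrier (triple_semigroup n)"
    by (auto simp: B_omega_def rees_quotient_def quotient_def cl)
  also have "\<dots> = insert empty_ideal {el i j k |i j k. k \<le> n}"
  proof -
    have "(0, 0, {}) \<in> empty_ideal"
      by (simp add: empty_ideal_def)
    moreover have "(i, j, {0..k}) \<notin> empty_ideal" for i j k
      by (simp add: empty_ideal_def)
    ultimately show ?thesis
      unfolding carrier_triple_semigroup by (force simp: image_Un image_iff el_def)
  qed
  finally show ?thesis .
qed

lemma empty_ideal_in_carrier [simp]: "empty_ideal \<in> carrier (B_omega n)"
  by (simp add: carrier_B_omega)

lemma el_in_carrier [simp]: "el i j k \<in> carrier (B_omega n) \<longleftrightarrow> k \<le> n"
  by (auto simp: carrier_B_omega)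

lemma B_omega_cases:
  assumes "X \<in> carrier (B_omega n)"
  obtains "X = empty_ideal" | i j k where "X = el i j k" "k \<le> n"
  using assms by (auto simp: carrier_B_omega)

lemma B_omega_mult:
  "X \<otimes>\<^bsub>B_omega n\<^esub> Y =
    (\<Union>x\<in>X. \<Union>y\<in>Y. rees_cong (triple_semigroup n) empty_ideal `` {triple_mult x y})"
  by (simp add: B_omega_def rees_quotient_def triple_semigroup_def)

lemma triple_mult_empty_ideal:
  assumes "x \<in> empty_ideal \<or> y \<in> empty_ideal"
  shows "triple_mult x y \<in> empty_ideal"
  using assms by (cases x; cases y) (auto simp: empty_ideal_def triple_mult_def translate_def)

lemma B_omega_mult_zero:
  assumes "X \<in> carrier (B_omega n)"
  shows "empty_ideal \<otimes>\<^bsub>B_omega n\<^esub> X = empty_ideal" "X \<otimes>\<^bsub>B_omega n\<^esub> empty_ideal = empty_ideal"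
proof -
  have z: "(0, 0, {}) \<in> empty_ideal"
    by (simp add: empty_ideal_def)
  \<comment> \<open>The product is a union over both classes, so an empty factor would give the
    empty set instead of zero.\<close>
  have ne: "X \<noteq> {}" "empty_ideal \<noteq> {}"
    using z assms by (auto simp: carrier_B_omega el_def)
  have cl: "rees_cong (triple_semigroup n) empty_ideal `` {triple_mult x y} = empty_ideal"
    if "x \<in> empty_ideal \<or> y \<in> empty_ideal" for x y
    using triple_mult_empty_ideal[OF that] empty_ideal_subset[of n]
    by (subst rees_cong_Image) auto
  show "empty_ideal \<otimes>\<^bsub>B_omega n\<^esub> X = empty_ideal" "X \<otimes>\<^bsub>B_omega n\<^esub> empty_ideal = empty_ideal"
    using ne by (auto simp: B_omega_mult cl)
qed

text \<open>Moving [0;k] down by d cuts off its first d points and leaves [0;k-d], or nothing if d >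
  k; the intersection with the other interval gives the minimum.\<close>

lemma triple_mult_interval:
  "triple_mult (i1, j1, {0..k1}) (i2, j2, {0..k2}) =
    (if j1 \<le> i2
     then (i1 + (i2 - j1), j2, if i2 - j1 \<le> k1 then {0..min k2 (k1 - (i2 - j1))} else {})
     else (i1, (j1 - i2) + j2, if j1 - i2 \<le> k2 then {0..min k1 (k2 - (j1 - i2))} else {}))"
proof -
  have tr: "int x \<in> translate (int a - int b) {0..k} \<longleftrightarrow> x + (b - a) \<le> k" if "a \<le> b" for x a b k
  proof -
    have "x + (b - a) \<le> k \<Longrightarrow> \<exists>y\<in>{0..k}. int x = int a - int b + int y"
      using that by (intro bexI[of _ "x + (b - a)"]) auto
    then show ?thesis
      using that by (auto simp: translate_def)
  qed
  show ?thesis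
    by (auto simp: triple_mult_def tr)
qed

lemma B_omega_mult_el:
  assumes "k1 \<le> n" "k2 \<le> n"
  shows "el i1 j1 k1 \<otimes>\<^bsub>B_omega n\<^esub> el i2 j2 k2 =
    (if j1 \<le> i2
     then if i2 - j1 \<le> k1 then el (i1 + (i2 - j1)) j2 (min k2 (k1 - (i2 - j1))) else empty_ideal
     else if j1 - i2 \<le> k2 then el i1 ((j1 - i2) + j2) (min k1 (k2 - (j1 - i2))) else empty_ideal)"
proof -
  have "rees_cong (triple_semigroup n) empty_ideal `` {(i, j, {0..k})} = el i j k" if "k \<le> n" for i j k
    using that by (subst rees_cong_Image[OF empty_ideal_subset])
      (auto simp: carrier_triple_semigroup empty_ideal_def el_def)
  moreover have "rees_cong (triple_semigroup n) empty_ideal `` {(i, j, {})} = empty_ideal" for i j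
    by (subst rees_cong_Image[OF empty_ideal_subset])
      (auto simp: carrier_triple_semigroup empty_ideal_def)
  ultimately show ?thesis
    using assms by (auto simp: B_omega_mult triple_mult_interval el_def[of i1 j1] el_def[of i2 j2])
qed

section \<open>Translations as injective endomorphisms\<close>

text \<open>Zero needs its own case: for a > 0 the translated \<open>empty_ideal\<close> is a proper
  subset of itself, hence not a class.\<close>

definition shift :: "nat \<Rightarrow> nat \<Rightarrow> (nat \<times> nat \<times> nat set) set \<Rightarrow> (nat \<times> nat \<times> nat set) set" where
  "shift n a = (\<lambda>X\<in>carrier (B_omega n).
     if X = empty_ideal then empty_ideal else (\<lambda>(i, j, F). (a + i, a + j, F)) ` X)"

lemma shift_empty_ideal [simp]: "shift n a empty_ideal = empty_ideal"
  by (simp add: shift_def)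

lemma shift_el [simp]: "k \<le> n \<Longrightarrow> shift n a (el i j k) = el (a + i) (a + j) k"
  by (simp add: shift_def) (simp add: el_def)

lemma shift_in_carrier [simp]:
  "X \<in> carrier (B_omega n) \<Longrightarrow> shift n a X \<in> carrier (B_omega n)"
  by (erule B_omega_cases) auto

lemma shift_extensional: "shift n a \<in> extensional (carrier (B_omega n))"
  by (simp add: shift_def)

text \<open>In a product the inner coordinates j1 and i2 enter only through their order and
  difference, which survive adding a to every coordinate.\<close>

lemma shift_mon: "shift n a \<in> mon (B_omega n) (B_omega n)"
proof -
  have "shift n a (X \<otimes>\<^bsub>B_omega n\<^esub> Y) = shift n a X \<otimes>\<^bsub>B_omega n\<^esub> shift n a Y"
    if XY: "X \<in> carrier (B_omega n)" "Y \<in> carrier (B_omega n)" for X Y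
    using XY(1)
  proof (cases rule: B_omega_cases)
    case 1
    then show ?thesis
      using XY by (simp add: B_omega_mult_zero)
  next
    case X: (2 i j k)
    show ?thesis
      using XY(2)
    proof (cases rule: B_omega_cases)
      case 1
      then show ?thesis
        using XY by (simp add: B_omega_mult_zero)
    next
      case Y: (2 i' j' k')
      show ?thesis
        using X(2) Y(2) unfolding X(1) Y(1) by (auto simp: B_omega_mult_el)
    qed
  qed
  moreover have "inj_on (shift n a) (carrier (B_omega n))"
    by (rule inj_onI) (elim B_omega_cases; auto)
  ultimately show ?thesis
    by (simp add: mon_def hom_def)
qed

lemma shift_compose: "compose (carrier (B_omega n)) (shift n a) (shift n b) = shift n (a + b)"
proof (rule extensionalityI)
  fix X
  assume X: "X \<in> carrier (B_omega n)"
  then show "compose (carrier (B_omega n)) (shift n a) (shift n b) X = shift n (a + b) X"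
    by (cases rule: B_omega_cases) (auto simp: compose_eq)
qed (auto simp: shift_extensional compose_def)

lemma shift_0: "shift n 0 = (\<lambda>X\<in>carrier (B_omega n). X)"
  by (rule ext) (auto simp: shift_def)

lemma inj_shift: "inj (shift n)"
proof (rule injI)
  fix a b
  assume "shift n a = shift n b"
  then have "shift n a (el 0 0 0) = shift n b (el 0 0 0)"
    by simp
  then show "a = b"
    by simp
qed

section \<open>Two rigidity facts on functions of natural numbers\<close>

text \<open>A walk with unit steps that turned back would repeat a value two steps later, so an
  injective one keeps its first direction; it cannot descend forever.\<close>

lemma inj_unit_steps_eq_add:
  fixes f :: "nat \<Rightarrow> nat"
  assumes inj: "inj f" and step: "\<And>i. f (Suc i) = Suc (f i) \<or> f i = Suc (f (Suc i))"
  shows "f i = f 0 + i"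
proof -
  have neq: "f (Suc (Suc i)) \<noteq> f i" for i
    using injD[OF inj, of "Suc (Suc i)" i] by auto
  have "f 1 = Suc (f 0)"
  proof (rule ccontr)
    assume "f 1 \<noteq> Suc (f 0)"
    then have start: "f 0 = Suc (f 1)"
      using step[of 0] by auto
    have down: "f i = Suc (f (Suc i))" for i
    proof (induction i)
      case (Suc i)
      then show ?case
        using step[of "Suc i"] neq[of i] by auto
    qed (use start in simp)
    have "f i + i = f 0" for i
    proof (induction i)
      case (Suc i)
      then show ?case
        using down[of i] by simp
    qed simp
    \<comment> \<open>After f 0 + 1 descending steps the value would be negative.\<close>
    from this[of "Suc (f 0)"] show False
      by simp
  qed
  then have "f (Suc i) = Suc (f i)" for i
  proof (induction i)
    case (Suc i)
    then show ?case
      using step[of "Suc i"] neq[of i] by auto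
  qed simp
  then show ?thesis
    by (induction i) auto
qed

text \<open>Counting up from g 0 \<ge> 0 bounds g k below; counting down from g n \<le> n bounds it
  above.\<close>

lemma strict_chain_eq:
  fixes g :: "nat \<Rightarrow> nat"
  assumes strict: "\<And>k. k < n \<Longrightarrow> g k < g (Suc k)" and top: "g n \<le> n" and "k \<le> n"
  shows "g k = k"
proof (rule antisym)
  have "j \<le> n \<Longrightarrow> g (n - j) \<le> n - j" for j
  proof (induction j)
    case (Suc j)
    then show ?case
      using strict[of "n - Suc j"] by (simp add: Suc_diff_Suc)
  qed (use top in simp)
  from this[of "n - k"] show "g k \<le> k"
    using \<open>k \<le> n\<close> by simp
  have "j \<le> n \<Longrightarrow> j \<le> g j" for j
  proof (induction j)
    case (Suc j)
    then show ?case
      using strict[of j] by simp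
  qed simp
  then show "k \<le> g k"
    using \<open>k \<le> n\<close> .
qed

section \<open>Interval inclusions and idempotents\<close>

text \<open>A composite of partial maps, left factor first, has its domain inside that of the first
  factor and its range inside that of the second.\<close>

lemma B_omega_mult_el_bounds:
  assumes "k1 \<le> n" "k2 \<le> n" "el i1 j1 k1 \<otimes>\<^bsub>B_omega n\<^esub> el i2 j2 k2 = el i j k"
  shows "i1 \<le> i" "i + k \<le> i1 + k1" "j2 \<le> j" "j + k \<le> j2 + k2" "k \<le> k1"
  using assms by (simp_all add: B_omega_mult_el split: if_splits) linarith+

lemma B_omega_idem_el:
  assumes "k \<le> n" "el i j k \<otimes>\<^bsub>B_omega n\<^esub> el i j k = el i j k"
  shows "i = j"
  using assms by (auto simp: B_omega_mult_el split: if_splits)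

text \<open>This expresses interval inclusion as an equation between products, which homomorphisms
  preserve.\<close>

lemma B_omega_idem_mult_eq_iff:
  assumes "k1 \<le> n" "k2 \<le> n"
  shows "el i1 i1 k1 \<otimes>\<^bsub>B_omega n\<^esub> el i2 i2 k2 = el i2 i2 k2 \<longleftrightarrow> i1 \<le> i2 \<and> i2 + k2 \<le> i1 + k1"
  using assms by (auto simp: B_omega_mult_el split: if_splits)

section \<open>Classification of the injective endomorphisms\<close>

text \<open>Zero lies below every \<open>el i i 0\<close>, so its image lies below infinitely many
  distinct idempotents. A non-zero image [p, p+k] has only finitely many above it: they start at
  most at p and have at most n+1 points.\<close>

lemma inj_endo_zero:
  assumes hom: "e \<in> hom (B_omega n) (B_omega n)" and inj: "inj_on e (carrier (B_omega n))"
  shows "e empty_ideal = empty_ideal"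
proof (rule ccontr)
  assume nz: "e empty_ideal \<noteq> empty_ideal"
  have "e empty_ideal \<in> carrier (B_omega n)"
    using hom by (auto simp: hom_def)
  then obtain p q k where pq: "e empty_ideal = el p q k" "k \<le> n"
    using nz by (cases rule: B_omega_cases) auto
  have "e empty_ideal \<otimes>\<^bsub>B_omega n\<^esub> e empty_ideal = e empty_ideal"
    using hom_mult[OF hom, of empty_ideal empty_ideal] by (simp add: B_omega_mult_zero)
  then have "p = q"
    using pq B_omega_idem_el by metis
  have "e (el i i 0) \<in> (\<lambda>(r, m). el r r m) ` ({..p} \<times> {..n})" for i
  proof -
    let ?x = "e (el i i 0)"
    have x: "?x \<otimes>\<^bsub>B_omega n\<^esub> e empty_ideal = e empty_ideal" "?x \<otimes>\<^bsub>B_omega n\<^esub> ?x = ?x"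
      using hom_mult[OF hom, of "el i i 0" empty_ideal] hom_mult[OF hom, of "el i i 0" "el i i 0"]
      by (simp_all add: B_omega_mult_zero B_omega_mult_el)
    have "?x \<in> carrier (B_omega n)"
      using hom by (auto simp: hom_def)
    then show ?thesis
    proof (cases rule: B_omega_cases)
      case 1
      then show ?thesis
        using x nz pq by (simp add: B_omega_mult_zero)
    next
      case (2 r s m)
      then have "r = s"
        using x(2) B_omega_idem_el by metis
      then have "r \<le> p"
        using x(1) 2 pq \<open>p = q\<close> B_omega_idem_mult_eq_iff by metis
      then show ?thesis
        using 2 \<open>r = s\<close> by auto
    qed
  qed
  then have "range (\<lambda>i. e (el i i 0)) \<subseteq> (\<lambda>(r, m). el r r m) ` ({..p} \<times> {..n})"
    by blast
  then have "finite (range (\<lambda>i. e (el i i 0)))"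
    by (rule finite_subset) simp
  moreover have "inj (\<lambda>i. e (el i i 0))"
    by (rule injI) (auto dest!: inj_onD[OF inj])
  ultimately show False
    by (simp add: finite_image_iff)
qed

lemma inj_endo_eq_shift:
  assumes n: "n \<ge> 1" and mon: "e \<in> mon (B_omega n) (B_omega n)"
    and ext: "e \<in> extensional (carrier (B_omega n))"
  obtains a where "e = shift n a"
proof -
  have hom: "e \<in> hom (B_omega n) (B_omega n)" and inj: "inj_on e (carrier (B_omega n))"
    using mon by (auto simp: mon_def)
  note zero = inj_endo_zero[OF hom inj]
  have el_image: "\<exists>p q m. e (el i j k) = el p q m \<and> m \<le> n" if "k \<le> n" for i j k
  proof -
    have "e (el i j k) \<in> carrier (B_omega n)"
      using hom that by (auto simp: hom_def)
    moreover have "e (el i j k) \<noteq> empty_ideal"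
      using inj_onD[OF inj, of "el i j k" empty_ideal] that zero by auto
    ultimately show ?thesis
      by (auto elim: B_omega_cases)
  qed
  have idem_image: "\<exists>p m. e (el i i k) = el p p m \<and> m \<le> n" if k: "k \<le> n" for i k
  proof -
    obtain p q m where pqm: "e (el i i k) = el p q m" "m \<le> n"
      using el_image[OF k] by blast
    have "e (el i i k) \<otimes>\<^bsub>B_omega n\<^esub> e (el i i k) = e (el i i k)"
      using hom_mult[OF hom, of "el i i k" "el i i k"] k by (simp add: B_omega_mult_el)
    then show ?thesis
      using pqm B_omega_idem_el by metis
  qed
  \<comment> \<open>The image of the interval [i, i+k] starts at \<open>P i k\<close> and has
    \<open>M i k\<close> + 1 points; both functions are unconstrained for k > n.\<close>
  have "\<forall>i k. \<exists>p m. k \<le> n \<longrightarrow> e (el i i k) = el p p m \<and> m \<le> n"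
    using idem_image by blast
  then obtain P M where PM: "\<And>i k. k \<le> n \<Longrightarrow> e (el i i k) = el (P i k) (P i k) (M i k)"
    and M_le: "\<And>i k. k \<le> n \<Longrightarrow> M i k \<le> n"
    unfolding choice_iff by blast
  have mono: "P i' k' \<le> P i k \<and> P i k + M i k \<le> P i' k' + M i' k'"
    if "i' \<le> i" "i + k \<le> i' + k'" "k' \<le> n" for i i' k k'
  proof -
    have kn: "k \<le> n"
      using that by simp
    have "e (el i' i' k') \<otimes>\<^bsub>B_omega n\<^esub> e (el i i k) = e (el i i k)"
      using hom_mult[OF hom, of "el i' i' k'" "el i i k"] that kn B_omega_idem_mult_eq_iff[of k' n k i' i]
      by simp
    then show ?thesis
      using PM that(3) kn M_le B_omega_idem_mult_eq_iff by metis
  qed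
  have M_eq: "M i k = k" if k: "k \<le> n" for i k
  proof (rule strict_chain_eq[of n])
    fix k
    assume k: "k < n"
    have le: "P i (Suc k) \<le> P i k" "P i k + M i k \<le> P i (Suc k) + M i (Suc k)"
      using mono[of i i k "Suc k"] k by auto
    \<comment> \<open>Nested image intervals with equally many points would coincide, against
      injectivity.\<close>
    have "e (el i i k) \<noteq> e (el i i (Suc k))"
      using inj_onD[OF inj, of "el i i k" "el i i (Suc k)"] k by auto
    then show "M i k < M i (Suc k)"
      using le PM[of k i] PM[of "Suc k" i] k by (cases "M i k = M i (Suc k)") auto
  qed (use M_le k in auto)
  \<comment> \<open>Since \<open>M i 0\<close> = 0, the image of the one-point interval at i is the
    single point f i.\<close>
  define f where "f i = P i 0" for i
  have f_bounds: "P i k \<le> f (i + t) \<and> f (i + t) \<le> P i k + k" if "k \<le> n" "t \<le> k" for i k t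
    using mono[of i "i + t" 0 k] that by (auto simp: f_def M_eq)
  have "inj f"
  proof (rule injI)
    fix i j
    assume "f i = f j"
    then have "e (el i i 0) = e (el j j 0)"
      by (simp add: PM f_def M_eq)
    then show "i = j"
      using inj_onD[OF inj, of "el i i 0" "el j j 0"] by simp
  qed
  define a where "a = f 0"
  have f: "f i = a + i" for i
    unfolding a_def
  proof (rule inj_unit_steps_eq_add[OF \<open>inj f\<close>])
    fix i
    \<comment> \<open>Both values lie in the image of [i, i+1], which has just two points; being
      distinct, they are adjacent. Here n \<ge> 1 makes that interval available.\<close>
    have "f i \<noteq> f (Suc i)"
      using injD[OF \<open>inj f\<close>, of i "Suc i"] by auto
    then show "f (Suc i) = Suc (f i) \<or> f i = Suc (f (Suc i))"
      using f_bounds[of 1 0 i] f_bounds[of 1 1 i] n by auto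
  qed
  \<comment> \<open>The image has k+1 points and contains both a+i and a+i+k, so it starts at
    a+i.\<close>
  have idem: "e (el i i k) = el (a + i) (a + i) k" if "k \<le> n" for i k
    using f_bounds[of k 0 i] f_bounds[of k k i] that f by (simp add: PM M_eq)
  have el: "e (el i j k) = el (a + i) (a + j) k" if k: "k \<le> n" for i j k
  proof -
    obtain p q m where pqm: "e (el i j k) = el p q m" "m \<le> n"
      using el_image[OF k] by blast
    obtain r s t where rst: "e (el j i k) = el r s t" "t \<le> n"
      using el_image[OF k] by blast
    \<comment> \<open>The first two equations confine the domain and range of the image to intervals
      of k+1 points. The third, a product with the image of the inverse element, forces m \<ge> k,
      so both intervals are filled.\<close>
    have eqs: "el (a + i) (a + i) k \<otimes>\<^bsub>B_omega n\<^esub> el p q m = el p q m"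
      "el p q m \<otimes>\<^bsub>B_omega n\<^esub> el (a + j) (a + j) k = el p q m"
      "el p q m \<otimes>\<^bsub>B_omega n\<^esub> el r s t = el (a + i) (a + i) k"
      using hom_mult[OF hom, of "el i i k" "el i j k"] hom_mult[OF hom, of "el i j k" "el j j k"]
        hom_mult[OF hom, of "el i j k" "el j i k"] k
      by (simp_all add: B_omega_mult_el idem pqm(1) rst(1))
    have "a + i \<le> p" "p + m \<le> a + i + k"
      using B_omega_mult_el_bounds(1,2)[OF k pqm(2) eqs(1)] .
    moreover have "a + j \<le> q" "q + m \<le> a + j + k"
      using B_omega_mult_el_bounds(3,4)[OF pqm(2) k eqs(2)] .
    moreover have "k \<le> m"
      using B_omega_mult_el_bounds(5)[OF pqm(2) rst(2) eqs(3)] .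
    ultimately show ?thesis
      using pqm(1) by simp
  qed
  have "e = shift n a"
  proof (rule extensionalityI[OF ext shift_extensional])
    fix X
    assume "X \<in> carrier (B_omega n)"
    then show "e X = shift n a X"
      by (cases rule: B_omega_cases) (simp_all add: zero el)
  qed
  then show thesis
    by (rule that)
qed

section \<open>The isomorphism and the automorphism group\<close>

lemma shift_iso:
  assumes "n \<ge> 1"
  shows "shift n \<in> iso nat_add_monoid (inj_endo_monoid (B_omega n))"
proof -
  have "range (shift n) = mon (B_omega n) (B_omega n) \<inter> extensional (carrier (B_omega n))"
    using shift_mon shift_extensional by (auto elim: inj_endo_eq_shift[OF assms])
  then show ?thesis
    using inj_shift[of n]
    by (auto simp: iso_def hom_def bij_betw_def nat_add_monoid_def inj_endo_monoid_def shift_compose)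
qed

text \<open>This turns \<open>shift_iso\<close> around. Closure of G is what allows h to be
  cancelled on a product of two preimages; no group axioms are assumed.\<close>

lemma iso_inv_into:
  assumes h: "h \<in> iso G H" and closed: "\<And>x y. x \<in> carrier G \<Longrightarrow> y \<in> carrier G \<Longrightarrow> x \<otimes>\<^bsub>G\<^esub> y \<in> carrier G"
  shows "inv_into (carrier G) h \<in> iso H G"
proof -
  let ?g = "inv_into (carrier G) h"
  have bij: "bij_betw h (carrier G) (carrier H)" and hom: "h \<in> hom G H"
    using h by (simp_all add: iso_def)
  have bij_inv: "bij_betw ?g (carrier H) (carrier G)"
    using bij by (rule bij_betw_inv_into)
  have "?g (x \<otimes>\<^bsub>H\<^esub> y) = ?g x \<otimes>\<^bsub>G\<^esub> ?g y" if xy: "x \<in> carrier H" "y \<in> carrier H" for x y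
  proof -
    have g: "?g x \<in> carrier G" "?g y \<in> carrier G"
      using bij_inv xy by (simp_all add: bij_betw_apply)
    have "h (?g x \<otimes>\<^bsub>G\<^esub> ?g y) = x \<otimes>\<^bsub>H\<^esub> y"
      using hom_mult[OF hom g] bij_betw_inv_into_right[OF bij] xy by simp
    then show ?thesis
      using bij_betw_inv_into_left[OF bij closed[OF g]] by simp
  qed
  moreover have "?g \<in> carrier H \<rightarrow> carrier G"
    using bij_inv by (rule bij_betw_imp_funcset)
  ultimately show ?thesis
    using bij_inv by (simp add: iso_def hom_def)
qed

lemma auto_B_omega:
  assumes "n \<ge> 1"
  shows "auto (B_omega n) = {\<lambda>X\<in>carrier (B_omega n). X}"
proof
  show "auto (B_omega n) \<subseteq> {\<lambda>X\<in>carrier (B_omega n). X}"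
  proof
    fix e
    assume e: "e \<in> auto (B_omega n)"
    then have bij: "bij_betw e (carrier (B_omega n)) (carrier (B_omega n))"
      by (auto simp: auto_def Bij_def)
    with e obtain a where a: "e = shift n a"
      using inj_endo_eq_shift[OF assms, of e] by (auto simp: auto_def Bij_def mon_def bij_betw_def)
    \<comment> \<open>A translation by a > 0 misses \<open>el 0 0 0\<close>, since both coordinates
      of a non-zero image are at least a.\<close>
    obtain X where X: "X \<in> carrier (B_omega n)" "shift n a X = el 0 0 0"
      using bij el_in_carrier[of 0 0 0 n] unfolding a bij_betw_def by (metis imageE le0)
    from X(1) have "a = 0"
      by (cases rule: B_omega_cases) (use X(2) in auto)
    then show "e \<in> {\<lambda>X\<in>carrier (B_omega n). X}"
      by (simp add: a shift_0)
  qed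
  have "shift n 0 \<in> auto (B_omega n)"
    using shift_mon[of n 0] shift_extensional[of n 0]
    by (auto simp: auto_def Bij_def mon_def bij_betw_def shift_0)
  then show "{\<lambda>X\<in>carrier (B_omega n). X} \<subseteq> auto (B_omega n)"
    by (simp add: shift_0)
qed

theorem corollary5:
  fixes n :: nat
  assumes "n \<ge> 1"
  shows "inj_endo_monoid (B_omega n) \<cong> nat_add_monoid \<and> trivial_group (AutoGroup (B_omega n))"
proof
  show "inj_endo_monoid (B_omega n) \<cong> nat_add_monoid"
    using iso_inv_into[OF shift_iso[OF assms]] by (auto simp: is_iso_def nat_add_monoid_def)
  let ?id = "\<lambda>X\<in>carrier (B_omega n). X" and ?A = "AutoGroup (B_omega n)"
  have id: "?id \<in> Bij (carrier (B_omega n))"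
    by (rule id_Bij)
  have carrier: "carrier ?A = {\<one>\<^bsub>?A\<^esub>}"
    by (simp add: AutoGroup_def BijGroup_def auto_B_omega[OF assms])
  have "compose (carrier (B_omega n)) ?id ?id = ?id"
    by (rule compose_Id) auto
  then have "\<one>\<^bsub>?A\<^esub> \<otimes>\<^bsub>?A\<^esub> \<one>\<^bsub>?A\<^esub> = \<one>\<^bsub>?A\<^esub>"
    using id by (simp add: AutoGroup_def BijGroup_def)
  \<comment> \<open>With a one-element carrier, the group axioms reduce to the product just
    computed.\<close>
  then have "group ?A"
    by (intro groupI) (simp_all add: carrier)
  with carrier show "trivial_group ?A"
    by (simp add: trivial_group_def)
qed

end
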